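(* A left stabilization of positive/negative type for virtual braids is not a consequence of VM0-, VM1- and VM2-moves; namely, for each of the two types (positive and negative), there is a pair of virtual braids which are related by a left stabilization of that type and which are not related by any finite sequence of VM0-, VM1- and VM2-moves.
   Context: The virtual braid group $VB_m$ ($m\ge1$) is the group with generators $\sigma_i,\tau_i$ ($1\le i\le m-1$) and relations: $\sigma_i\sigma_j=\sigma_j\sigma_i$ for $|i-j|>1$; $\sigma_i\sigma_{i+1}\sigma_i=\sigma_{i+1}\sigma_i\sigma_{i+1}$; $\tau_i^2=1$; $\tau_i\tau_j=\tau_j\tau_i$ for $|i-j|>1$; $\tau_i\tau_{i+1}\tau_i=\tau_{i+1}\tau_i\tau_{i+1}$; $\sigma_i\tau_j=\tau_j\sigma_i$ for $|i-j|>1$; $\sigma_i\tau_{i+1}\tau_i=\tau_{i+1}\tau_i\sigma_{i+1}$. Its elements are called virtual braids of degree $m$. The homomorphism $\iota_s^t:VB_m\to VB_{m+s+t}$ is given by $\sigma_i\mapsto\sigma_{i+s}$, $\tau_i\mapsto\tau_{i+s}$ (adding $s$ trivial strands to the left and $t$ to the right). A left stabilization of positive (respectively negative) type is the replacement of $b\in VB_m$ by $\iota_1^0(b)\sigma_1$ (respectively $\iota_1^0(b)\sigma_1^{-1}$) in $VB_{m+1}$. Moves. (VM0) a braid move: applying a defining relation of the virtual braid group (trivial on elements of $VB_m$; it matters only for words/diagrams). (VM1) a conjugation: $b_1\mapsto b_2^{-1}b_1b_2$ with $b_1,b_2\in VB_m$. (VM2) a right stabilization of positive, negative or virtual type, replacing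 $b\in VB_m$ by $\iota_0^1(b)\sigma_m$, $\iota_0^1(b)\sigma_m^{-1}$ or $\iota_0^1(b)\tau_m\in VB_{m+1}$, and its inverse operation. *)

theory Defs
  imports "HOL-Algebra.Group"
begin

section \<open>Groups given by generators and relations\<close>

text \<open>A word over the generators is a list of letters \<open>(g, e)\<close>; the letter stands for \<open>g\<close>
  if \<open>e\<close> is \<open>True\<close> and for the formal inverse of \<open>g\<close> if \<open>e\<close> is \<open>False\<close>.\<close>

type_synonym 'g word = "('g \<times> bool) list"

abbreviation words :: "'g set \<Rightarrow> 'g word set"
  where "words S \<equiv> lists (S \<times> UNIV)"

inductive_set pres_cong :: "'g set \<Rightarrow> ('g word \<times> 'g word) set \<Rightarrow> ('g word \<times> 'g word) set"
  for S R
where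
  refl: "w \<in> words S \<Longrightarrow> (w, w) \<in> pres_cong S R"
| sym: "(u, v) \<in> pres_cong S R \<Longrightarrow> (v, u) \<in> pres_cong S R"
| trans: "(u, v) \<in> pres_cong S R \<Longrightarrow> (v, w) \<in> pres_cong S R \<Longrightarrow> (u, w) \<in> pres_cong S R"
| compat: "(u, v) \<in> pres_cong S R \<Longrightarrow> a \<in> words S \<Longrightarrow> b \<in> words S
    \<Longrightarrow> (a @ u @ b, a @ v @ b) \<in> pres_cong S R"
| cancel: "g \<in> S \<Longrightarrow> ([(g, e), (g, \<not> e)], []) \<in> pres_cong S R"
| rel: "(u, v) \<in> R \<Longrightarrow> u \<in> words S \<Longrightarrow> v \<in> words S \<Longrightarrow> (u, v) \<in> pres_cong S R"

definition presented_group :: "'g set \<Rightarrow> ('g word \<times> 'g word) set \<Rightarrow> 'g word set monoid"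
  where "presented_group S R =
    \<lparr>carrier = words S // pres_cong S R,
     mult = (\<lambda>X Y. \<Union>u\<in>X. \<Union>v\<in>Y. pres_cong S R `` {u @ v}),
     one = pres_cong S R `` {[]}\<rparr>"

lemma pres_cong_words: "(u, v) \<in> pres_cong S R \<Longrightarrow> u \<in> words S \<and> v \<in> words S"
  by (induction rule: pres_cong.induct) auto

lemma equiv_pres_cong: "equiv (words S) (pres_cong S R)"
proof (rule equivI)
  show "pres_cong S R \<subseteq> words S \<times> words S"
    by (auto dest: pres_cong_words)
  show "refl_on (words S) (pres_cong S R)"
    by (rule refl_onI) (rule pres_cong.refl)
  show "sym (pres_cong S R)"
    by (rule symI) (rule pres_cong.sym)
  show "trans (pres_cong S R)"
    by (rule transI) (rule pres_cong.trans)
qed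

lemma pres_cong_append:
  assumes "(u, u') \<in> pres_cong S R" "(v, v') \<in> pres_cong S R"
  shows "(u @ v, u' @ v') \<in> pres_cong S R"
proof -
  have "([] @ u @ v, [] @ u' @ v) \<in> pres_cong S R"
    using assms pres_cong_words[OF assms(2)] by (intro pres_cong.compat) auto
  then have 1: "(u @ v, u' @ v) \<in> pres_cong S R" by simp
  have "(u' @ v @ [], u' @ v' @ []) \<in> pres_cong S R"
    using assms pres_cong_words[OF assms(1)] by (intro pres_cong.compat) auto
  then have "(u' @ v, u' @ v') \<in> pres_cong S R" by simp
  with 1 show ?thesis by (rule pres_cong.trans)
qed

lemma pres_mult_class:
  assumes "u \<in> words S" "v \<in> words S"
  shows "mult (presented_group S R) (pres_cong S R `` {u}) (pres_cong S R `` {v})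
    = pres_cong S R `` {u @ v}"
proof -
  have "congruent2 (pres_cong S R) (pres_cong S R) (\<lambda>u v. pres_cong S R `` {u @ v})"
    by (intro congruent2I' equiv_class_eq[OF equiv_pres_cong] pres_cong_append)
  from UN_equiv_class2[OF equiv_pres_cong equiv_pres_cong this assms]
  show ?thesis by (simp add: presented_group_def)
qed

lemma pres_carrierE:
  assumes "X \<in> carrier (presented_group S R)"
  obtains w where "w \<in> words S" "X = pres_cong S R `` {w}"
proof -
  from assms have "X \<in> words S // pres_cong S R"
    by (simp add: presented_group_def)
  then show thesis
    by (rule quotientE) (rule that)
qed

lemma pres_class_carrier:
  "w \<in> words S \<Longrightarrow> pres_cong S R `` {w} \<in> carrier (presented_group S R)"
  by (simp add: presented_group_def quotientI)

definition word_inv :: "'g word \<Rightarrow> 'g word"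
  where "word_inv w = rev (map (\<lambda>(g, e). (g, \<not> e)) w)"

lemma word_inv_words: "w \<in> words S \<Longrightarrow> word_inv w \<in> words S"
  by (auto simp: word_inv_def)

lemma word_inv_cancel:
  "w \<in> words S \<Longrightarrow> (word_inv w @ w, []) \<in> pres_cong S R"
proof (induction w)
  case Nil
  then show ?case by (simp add: word_inv_def pres_cong.refl)
next
  case (Cons x w)
  obtain g e where x: "x = (g, e)" by force
  with Cons.prems have g: "g \<in> S" and w: "w \<in> words S" by auto
  have "(word_inv w @ [(g, \<not> e), (g, \<not> \<not> e)] @ w, word_inv w @ [] @ w) \<in> pres_cong S R"
    by (intro pres_cong.compat pres_cong.cancel g w word_inv_words)
  then have "(word_inv (x # w) @ x # w, word_inv w @ w) \<in> pres_cong S R"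
    by (simp add: word_inv_def x)
  then show ?case
    using Cons.IH[OF w] by (rule pres_cong.trans)
qed

lemma group_presented_group: "group (presented_group S R)"
proof (rule groupI)
  let ?G = "presented_group S R"
  have one: "\<one>\<^bsub>?G\<^esub> = pres_cong S R `` {[]}"
    by (simp add: presented_group_def)
  show "\<one>\<^bsub>?G\<^esub> \<in> carrier ?G"
    by (simp add: one pres_class_carrier)
  fix X assume X: "X \<in> carrier ?G"
  then obtain u where u: "u \<in> words S" "X = pres_cong S R `` {u}"
    by (rule pres_carrierE)
  show "\<one>\<^bsub>?G\<^esub> \<otimes>\<^bsub>?G\<^esub> X = X"
    using u by (simp add: one pres_mult_class)
  have "pres_cong S R `` {word_inv u} \<otimes>\<^bsub>?G\<^esub> X = \<one>\<^bsub>?G\<^esub>"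
    unfolding one u(2) pres_mult_class[OF word_inv_words[OF u(1)] u(1)]
    by (intro equiv_class_eq[OF equiv_pres_cong] word_inv_cancel u(1))
  then show "\<exists>Y\<in>carrier ?G. Y \<otimes>\<^bsub>?G\<^esub> X = \<one>\<^bsub>?G\<^esub>"
    using pres_class_carrier[OF word_inv_words[OF u(1)]] by blast
  fix Y assume Y: "Y \<in> carrier ?G"
  then obtain v where v: "v \<in> words S" "Y = pres_cong S R `` {v}"
    by (rule pres_carrierE)
  show "X \<otimes>\<^bsub>?G\<^esub> Y \<in> carrier ?G"
    using u v by (simp add: pres_mult_class pres_class_carrier)
  fix Z assume Z: "Z \<in> carrier ?G"
  then obtain w where w: "w \<in> words S" "Z = pres_cong S R `` {w}"
    by (rule pres_carrierE)
  show "X \<otimes>\<^bsub>?G\<^esub> Y \<otimes>\<^bsub>?G\<^esub> Z = X \<otimes>\<^bsub>?G\<^esub> (Y \<otimes>\<^bsub>?G\<^esub> Z)"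
    using u v w by (simp add: pres_mult_class)
qed


section \<open>Virtual braid groups\<close>

datatype vgen = Sig nat | Tau nat

abbreviation sg :: "nat \<Rightarrow> vgen \<times> bool" where "sg i \<equiv> (Sig i, True)"
abbreviation ta :: "nat \<Rightarrow> vgen \<times> bool" where "ta i \<equiv> (Tau i, True)"

definition vb_gens :: "nat \<Rightarrow> vgen set"
  where "vb_gens m = Sig ` {1..<m} \<union> Tau ` {1..<m}"

definition far :: "nat \<Rightarrow> nat \<Rightarrow> nat \<Rightarrow> bool"
  where "far m i j \<longleftrightarrow> i \<in> {1..<m} \<and> j \<in> {1..<m} \<and> \<bar>int i - int j\<bar> > 1"

definition vb_rels :: "nat \<Rightarrow> (vgen word \<times> vgen word) set"
  where "vb_rels m =
      {([sg i, sg j], [sg j, sg i]) | i j. far m i j}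
    \<union> {([sg i, sg (i+1), sg i], [sg (i+1), sg i, sg (i+1)]) | i. 1 \<le> i \<and> i + 1 < m}
    \<union> {([ta i, ta i], []) | i. 1 \<le> i \<and> i < m}
    \<union> {([ta i, ta j], [ta j, ta i]) | i j. far m i j}
    \<union> {([ta i, ta (i+1), ta i], [ta (i+1), ta i, ta (i+1)]) | i. 1 \<le> i \<and> i + 1 < m}
    \<union> {([sg i, ta j], [ta j, sg i]) | i j. far m i j}
    \<union> {([sg i, ta (i+1), ta i], [ta (i+1), ta i, sg (i+1)]) | i. 1 \<le> i \<and> i + 1 < m}"

type_synonym vbraid = "vgen word set"

definition VB :: "nat \<Rightarrow> vbraid monoid"
  where "VB m = presented_group (vb_gens m) (vb_rels m)"

definition vb_class :: "nat \<Rightarrow> vgen word \<Rightarrow> vbraid"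
  where "vb_class m w = pres_cong (vb_gens m) (vb_rels m) `` {w}"

definition vsigma :: "nat \<Rightarrow> nat \<Rightarrow> vbraid"
  where "vsigma m i = vb_class m [sg i]"

definition vtau :: "nat \<Rightarrow> nat \<Rightarrow> vbraid"
  where "vtau m i = vb_class m [ta i]"

fun shift_gen :: "nat \<Rightarrow> vgen \<Rightarrow> vgen"
where
  "shift_gen s (Sig i) = Sig (i + s)"
| "shift_gen s (Tau i) = Tau (i + s)"

definition shift_word :: "nat \<Rightarrow> vgen word \<Rightarrow> vgen word"
  where "shift_word s = map (map_prod (shift_gen s) id)"

text \<open>The source degree \<open>m\<close> is an explicit argument.  The union is over a single class, since
  shifting respects the congruence; see \<open>vb_iota_class\<close> and \<open>vb_iota_hom\<close> below.\<close>

definition vb_iota :: "nat \<Rightarrow> nat \<Rightarrow> nat \<Rightarrow> vbraid \<Rightarrow> vbraid"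
  where "vb_iota m s t X = (\<Union>w\<in>X. vb_class (m + s + t) (shift_word s w))"

lemma group_VB: "group (VB m)"
  unfolding VB_def by (rule group_presented_group)

lemma vb_rels_words: "(u, v) \<in> vb_rels m \<Longrightarrow> u \<in> words (vb_gens m) \<and> v \<in> words (vb_gens m)"
  by (auto simp: vb_rels_def vb_gens_def far_def)

lemma vsigma_carrier: "1 \<le> i \<Longrightarrow> i < m \<Longrightarrow> vsigma m i \<in> carrier (VB m)"
  by (auto simp: vsigma_def vb_class_def VB_def vb_gens_def intro!: pres_class_carrier)

lemma vtau_carrier: "1 \<le> i \<Longrightarrow> i < m \<Longrightarrow> vtau m i \<in> carrier (VB m)"
  by (auto simp: vtau_def vb_class_def VB_def vb_gens_def intro!: pres_class_carrier)

lemma shift_gen_gens: "g \<in> vb_gens m \<Longrightarrow> shift_gen s g \<in> vb_gens (m + s + t)"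
  by (auto simp: vb_gens_def)

lemma shift_word_words:
  "w \<in> words (vb_gens m) \<Longrightarrow> shift_word s w \<in> words (vb_gens (m + s + t))"
  by (induction w) (auto simp: shift_word_def shift_gen_gens)

lemma shift_word_rels:
  "(u, v) \<in> vb_rels m \<Longrightarrow> (shift_word s u, shift_word s v) \<in> vb_rels (m + s + t)"
  unfolding vb_rels_def by (elim UnE) (force simp: shift_word_def far_def)+

lemma shift_word_cong:
  "(u, v) \<in> pres_cong (vb_gens m) (vb_rels m) \<Longrightarrow>
   (shift_word s u, shift_word s v) \<in> pres_cong (vb_gens (m + s + t)) (vb_rels (m + s + t))"
proof (induction rule: pres_cong.induct)
  case (refl w)
  then show ?case by (intro pres_cong.refl shift_word_words)
next
  case (sym u v)
  show ?case by (rule pres_cong.sym[OF sym.IH])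
next
  case (trans u v w)
  show ?case by (rule pres_cong.trans[OF trans.IH])
next
  case (compat u v a b)
  from pres_cong.compat[OF compat.IH shift_word_words shift_word_words, OF compat.hyps(2,3)]
  show ?case by (simp add: shift_word_def)
next
  case (cancel g e)
  then show ?case
    by (simp add: shift_word_def shift_gen_gens pres_cong.cancel)
next
  case (rel u v)
  then show ?case by (intro pres_cong.rel shift_word_rels shift_word_words)
qed

lemma vb_iota_class:
  assumes "w \<in> words (vb_gens m)"
  shows "vb_iota m s t (vb_class m w) = vb_class (m + s + t) (shift_word s w)"
proof -
  have "(\<lambda>w. vb_class (m + s + t) (shift_word s w)) respects pres_cong (vb_gens m) (vb_rels m)"
    unfolding vb_class_def
    by (intro congruentI equiv_class_eq[OF equiv_pres_cong] shift_word_cong)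
  from UN_equiv_class[OF equiv_pres_cong this assms]
  show ?thesis by (simp add: vb_iota_def vb_class_def)
qed

lemma vb_iota_hom: "vb_iota m s t \<in> hom (VB m) (VB (m + s + t))"
proof (rule homI)
  fix X assume "X \<in> carrier (VB m)"
  then obtain u where u: "u \<in> words (vb_gens m)" "X = vb_class m u"
    unfolding VB_def vb_class_def by (rule pres_carrierE)
  show "vb_iota m s t X \<in> carrier (VB (m + s + t))"
    unfolding u(2) vb_iota_class[OF u(1)] unfolding VB_def vb_class_def
    by (intro pres_class_carrier shift_word_words u(1))
  fix Y assume "Y \<in> carrier (VB m)"
  then obtain v where v: "v \<in> words (vb_gens m)" "Y = vb_class m v"
    unfolding VB_def vb_class_def by (rule pres_carrierE)
  have mult: "vb_class k x \<otimes>\<^bsub>VB k\<^esub> vb_class k y = vb_class k (x @ y)"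
    if "x \<in> words (vb_gens k)" "y \<in> words (vb_gens k)" for k x y
    using that unfolding VB_def vb_class_def by (rule pres_mult_class)
  have uv: "u @ v \<in> words (vb_gens m)" using u(1) v(1) by simp
  show "vb_iota m s t (X \<otimes>\<^bsub>VB m\<^esub> Y)
      = vb_iota m s t X \<otimes>\<^bsub>VB (m + s + t)\<^esub> vb_iota m s t Y"
    unfolding u(2) v(2) mult[OF u(1) v(1)] vb_iota_class[OF u(1)] vb_iota_class[OF v(1)]
      vb_iota_class[OF uv] mult[OF shift_word_words[OF u(1)] shift_word_words[OF v(1)]]
    by (simp add: shift_word_def)
qed

lemma vb_iota_vsigma:
  "1 \<le> i \<Longrightarrow> i < m \<Longrightarrow> vb_iota m s t (vsigma m i) = vsigma (m + s + t) (i + s)"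
  unfolding vsigma_def by (subst vb_iota_class) (auto simp: vb_gens_def shift_word_def)

lemma vb_iota_vtau:
  "1 \<le> i \<Longrightarrow> i < m \<Longrightarrow> vb_iota m s t (vtau m i) = vtau (m + s + t) (i + s)"
  unfolding vtau_def by (subst vb_iota_class) (auto simp: vb_gens_def shift_word_def)


section \<open>Moves\<close>

text \<open>A virtual braid is recorded as a pair \<open>(m, b)\<close> of its degree \<open>m \<ge> 1\<close> and an element \<open>b\<close>
  of \<open>VB m\<close>.\<close>

inductive left_stab_pos :: "nat \<times> vbraid \<Rightarrow> nat \<times> vbraid \<Rightarrow> bool"
where
  "1 \<le> m \<Longrightarrow> b \<in> carrier (VB m)
    \<Longrightarrow> left_stab_pos (m, b) (m + 1, vb_iota m 1 0 b \<otimes>\<^bsub>VB (m + 1)\<^esub> vsigma (m + 1) 1)"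

inductive left_stab_neg :: "nat \<times> vbraid \<Rightarrow> nat \<times> vbraid \<Rightarrow> bool"
where
  "1 \<le> m \<Longrightarrow> b \<in> carrier (VB m)
    \<Longrightarrow> left_stab_neg (m, b)
          (m + 1, vb_iota m 1 0 b \<otimes>\<^bsub>VB (m + 1)\<^esub> inv\<^bsub>VB (m + 1)\<^esub> vsigma (m + 1) 1)"

inductive right_stab :: "nat \<times> vbraid \<Rightarrow> nat \<times> vbraid \<Rightarrow> bool"
where
  pos: "1 \<le> m \<Longrightarrow> b \<in> carrier (VB m)
    \<Longrightarrow> right_stab (m, b) (m + 1, vb_iota m 0 1 b \<otimes>\<^bsub>VB (m + 1)\<^esub> vsigma (m + 1) m)"
| neg: "1 \<le> m \<Longrightarrow> b \<in> carrier (VB m)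
    \<Longrightarrow> right_stab (m, b)
          (m + 1, vb_iota m 0 1 b \<otimes>\<^bsub>VB (m + 1)\<^esub> inv\<^bsub>VB (m + 1)\<^esub> vsigma (m + 1) m)"
| virt: "1 \<le> m \<Longrightarrow> b \<in> carrier (VB m)
    \<Longrightarrow> right_stab (m, b) (m + 1, vb_iota m 0 1 b \<otimes>\<^bsub>VB (m + 1)\<^esub> vtau (m + 1) m)"

text \<open>Braid moves (VM0) act trivially here because the elements of \<open>VB m\<close> are already
  classes of words modulo the defining relations.\<close>

inductive vm_move :: "nat \<times> vbraid \<Rightarrow> nat \<times> vbraid \<Rightarrow> bool"
where
  vm0: "1 \<le> m \<Longrightarrow> b \<in> carrier (VB m) \<Longrightarrow> vm_move (m, b) (m, b)"
| vm1: "1 \<le> m \<Longrightarrow> b1 \<in> carrier (VB m) \<Longrightarrow> b2 \<in> carrier (VB m)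
    \<Longrightarrow> vm_move (m, b1) (m, inv\<^bsub>VB m\<^esub> b2 \<otimes>\<^bsub>VB m\<^esub> b1 \<otimes>\<^bsub>VB m\<^esub> b2)"
| vm2: "right_stab p q \<Longrightarrow> vm_move p q"
| vm2_inverse: "right_stab q p \<Longrightarrow> vm_move p q"

abbreviation vm_related :: "nat \<times> vbraid \<Rightarrow> nat \<times> vbraid \<Rightarrow> bool"
  where "vm_related \<equiv> vm_move\<^sup>*\<^sup>*"

end

theory Submission
  imports Defs "Jordan_Normal_Form.Determinant"
begin

text \<open>The generalized Burau representation \<open>M\<close> of \<open>VB m\<close> sends \<open>\<sigma>\<close> to the block
  \<open>((1 - st, s), (t, 0))\<close> and \<open>\<tau>\<close> to the flip; its determinant \<open>det (1 - M b)\<close> is conjugation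
  invariant.  A right stabilization of type \<open>\<sigma>\<close>, \<open>\<sigma>\<inverse>\<close>, \<open>\<tau>\<close> multiplies it by
  \<open>1\<close>, \<open>1/(st)\<close>, \<open>1\<close>, whereas a left one of type \<open>\<sigma>\<close>, \<open>\<sigma>\<inverse>\<close> multiplies it by \<open>st\<close>, \<open>1\<close>.
  Let \<open>w\<close> be the writhe and \<open>c\<close> the number of cycles of the permutation obtained from
  \<open>\<sigma> \<mapsto> 1\<close> and \<open>\<tau> \<mapsto> flip\<close>.  Any real stabilization adds one to \<open>c\<close> and \<open>\<plusminus>1\<close> to \<open>w\<close>, and
  a virtual one changes neither, so \<open>det (1 - M b) (st) powr ((c - w)/2)\<close> is invariant under
  all VM-moves, while each left stabilization multiplies it by \<open>st\<close>.  We take \<open>s = t = 2\<close> and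
  the braid \<open>\<sigma>\<^sub>1\<tau>\<^sub>1\<close>, on which the invariant does not vanish.\<close>

section \<open>Virtual braid actions from set-theoretic Yang-Baxter solutions\<close>

text \<open>Strands are numbered from 0, so a letter with index \<open>i\<close> involves
  coordinates \<open>i - 1\<close> and \<open>i\<close>. Colourings live on all naturals: adding
  strands on the right then leaves the action unchanged.\<close>

definition step :: "('a \<Rightarrow> 'a \<Rightarrow> 'a) \<Rightarrow> ('a \<Rightarrow> 'a \<Rightarrow> 'a) \<Rightarrow> nat \<Rightarrow> (nat \<Rightarrow> 'a) \<Rightarrow> nat \<Rightarrow> 'a"
  where "step f g i v = v(i - 1 := f (v (i - 1)) (v i), i := g (v (i - 1)) (v i))"

abbreviation swap_step :: "nat \<Rightarrow> (nat \<Rightarrow> 'a) \<Rightarrow> nat \<Rightarrow> 'a"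
  where "swap_step \<equiv> step (\<lambda>x y. y) (\<lambda>x y. x)"

lemma step_Suc: "step f g (Suc k) v = v(k := f (v k) (v (Suc k)), Suc k := g (v k) (v (Suc k)))"
  by (simp add: step_def)

text \<open>The coordinate pairs of the two letters are disjoint. Allowing two different switches
  covers all three kinds of far commutation at once.\<close>

lemma step_far_commute:
  assumes "far m i j"
  shows "step f g i (step f' g' j v) = step f' g' j (step f g i v)"
proof -
  obtain k l where "i = Suc k" "j = Suc l"
    using assms by (cases i; cases j) (auto simp: far_def)
  with assms show ?thesis
    by (auto simp: far_def step_Suc fun_eq_iff)
qed

lemma pres_cong_invariant:
  assumes "(u, v) \<in> pres_cong S R"
    and "\<And>u v a b. F u = F v \<Longrightarrow> F (a @ u @ b) = F (a @ v @ b)"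
    and "\<And>g e. g \<in> S \<Longrightarrow> F [(g, e), (g, \<not> e)] = F []"
    and "\<And>u v. (u, v) \<in> R \<Longrightarrow> F u = F v"
  shows "F u = F v"
  using assms(1) by (induction rule: pres_cong.induct) (auto intro: assms(2-4))

text \<open>The map \<open>(x, y)\<close> to \<open>(f x y, g x y)\<close> is an invertible solution
  of the Yang-Baxter equation, written coordinatewise, with inverse given by \<open>f'\<close> and
  \<open>g'\<close>. The mixed relation holds for every switch, because flips only permute
  coordinates.\<close>

locale vb_switch =
  fixes f g f' g' :: "'a \<Rightarrow> 'a \<Rightarrow> 'a"
  assumes left_inverse: "f' (f x y) (g x y) = x" "g' (f x y) (g x y) = y"
    and right_inverse: "f (f' x y) (g' x y) = x" "g (f' x y) (g' x y) = y"
    and yang_baxter: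
      "f (f x y) (f (g x y) z) = f x (f y z)"
      "g (f x y) (f (g x y) z) = f (g x (f y z)) (g y z)"
      "g (g x y) z = g (g x (f y z)) (g y z)"
begin

fun letter_act :: "vgen \<times> bool \<Rightarrow> (nat \<Rightarrow> 'a) \<Rightarrow> nat \<Rightarrow> 'a"
where
  "letter_act (Sig i, e) = (if e then step f g i else step f' g' i)"
| "letter_act (Tau i, e) = swap_step i"

text \<open>The rightmost letter acts first, so concatenation of words becomes composition of maps
  in the same order.\<close>

definition act :: "vgen word \<Rightarrow> (nat \<Rightarrow> 'a) \<Rightarrow> nat \<Rightarrow> 'a"
  where "act w = foldr letter_act w"

lemma act_Nil [simp]: "act [] v = v"
  and act_Cons [simp]: "act (x # w) v = letter_act x (act w v)"
  by (simp_all add: act_def)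

lemma act_append: "act (u @ w) v = act u (act w v)"
  by (simp add: act_def)

lemma letter_act_cancel:
  assumes "x \<in> vb_gens m"
  shows "letter_act (x, e) (letter_act (x, \<not> e) v) = v"
proof -
  obtain k where "x = Sig (Suc k) \<or> x = Tau (Suc k)"
    using assms by (auto simp: vb_gens_def) (metis Suc_le_D)+
  then show ?thesis
    by (auto simp: step_Suc fun_eq_iff left_inverse right_inverse)
qed

lemma act_rels:
  assumes "(u, v) \<in> vb_rels m"
  shows "act u = act v"
  using assms unfolding vb_rels_def
proof (elim UnE; clarsimp simp: fun_eq_iff[of "act _"])
  fix i j x
  assume far: "far m i j"
  show "step f g i (step f g j x) = step f g j (step f g i x)"
    and "swap_step i (swap_step j x) = swap_step j (swap_step i x)"
    and "step f g i (swap_step j x) = swap_step j (step f g i x)"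
    by (simp_all add: step_far_commute[OF far])
next
  fix i :: nat and x :: "nat \<Rightarrow> 'a"
  assume "Suc 0 \<le> i"
  then obtain k where i: "i = Suc k"
    by (metis Suc_le_D)
  show "step f g i (step f g (Suc i) (step f g i x)) =
      step f g (Suc i) (step f g i (step f g (Suc i) x))"
    using yang_baxter[of "x k" "x (Suc k)" "x (Suc (Suc k))"]
    by (auto simp: i step_Suc fun_eq_iff)
  show "swap_step i (swap_step i x) = x"
    by (auto simp: i step_Suc fun_eq_iff)
  show "swap_step i (swap_step (Suc i) (swap_step i x)) =
      swap_step (Suc i) (swap_step i (swap_step (Suc i) x))"
    by (auto simp: i step_Suc fun_eq_iff)
  show "step f g i (swap_step (Suc i) (swap_step i x)) =
      swap_step (Suc i) (swap_step i (step f g (Suc i) x))"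
    by (auto simp: i step_Suc fun_eq_iff)
qed

lemma act_cong:
  assumes "(u, v) \<in> pres_cong (vb_gens m) (vb_rels m)"
  shows "act u = act v"
  using assms
proof (rule pres_cong_invariant)
  show "act [(x, e), (x, \<not> e)] = act []" if "x \<in> vb_gens m" for x e
    using letter_act_cancel[OF that] by (simp add: fun_eq_iff[of "act _"])
qed (simp_all add: act_append act_rels fun_eq_iff[of "act _"])

lemma act_word_inv:
  assumes "w \<in> words (vb_gens m)"
  shows "act (word_inv w) (act w v) = v" "act w (act (word_inv w) v) = v"
proof -
  have inv: "act (word_inv u) (act u v) = v" if "u \<in> words (vb_gens m)" for u
    using act_cong[OF word_inv_cancel[OF that]] by (metis act_Nil act_append)
  show "act (word_inv w) (act w v) = v"
    using assms by (rule inv)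
  have "word_inv (word_inv w) = w"
    by (simp add: word_inv_def rev_map comp_def case_prod_beta)
  then show "act w (act (word_inv w) v) = v"
    using inv[OF word_inv_words[OF assms]] by simp
qed

lemma act_beyond:
  "w \<in> words (vb_gens m) \<Longrightarrow> m \<le> i \<Longrightarrow> act w v i = v i"
  by (induction w) (auto simp: vb_gens_def step_def)

lemma act_upd_beyond:
  "w \<in> words (vb_gens m) \<Longrightarrow> m \<le> i \<Longrightarrow> act w (v(i := x)) = (act w v)(i := x)"
  by (induction w) (auto simp: vb_gens_def step_def fun_eq_iff)

end

section \<open>The writhe\<close>

fun letter_sign :: "vgen \<times> bool \<Rightarrow> int"
where
  "letter_sign (Sig i, e) = (if e then 1 else -1)"
| "letter_sign (Tau i, e) = 0"

definition writhe :: "vgen word \<Rightarrow> int"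
  where "writhe w = sum_list (map letter_sign w)"

lemma writhe_append: "writhe (u @ w) = writhe u + writhe w"
  by (simp add: writhe_def)

text \<open>Both sides of every defining relation contain equally many real crossings, all
  positive.\<close>

lemma writhe_cong:
  assumes "(u, v) \<in> pres_cong (vb_gens m) (vb_rels m)"
  shows "writhe u = writhe v"
  using assms
proof (rule pres_cong_invariant)
  show "writhe [(x, e), (x, \<not> e)] = writhe []" for x e
    by (cases x) (auto simp: writhe_def)
  show "writhe u = writhe v" if "(u, v) \<in> vb_rels m" for u v
    using that by (auto simp: vb_rels_def writhe_def)
qed (simp add: writhe_append)

lemma writhe_word_inv: "writhe (word_inv w) = - writhe w"
proof (induction w)
  case (Cons x w)
  obtain g e where "x = (g, e)" by force
  then show ?case
    using Cons by (cases g) (auto simp: writhe_def word_inv_def)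
qed (simp add: writhe_def word_inv_def)


section \<open>The smoothing count\<close>

interpretation smooth: vb_switch "\<lambda>x y. x" "\<lambda>x y. y" "\<lambda>x y. x" "\<lambda>x (y::bool). y"
  by unfold_locales simp_all

text \<open>This set has \<open>2 ^ c\<close> elements, where \<open>c\<close> is the number of cycles of the permutation that
  is obtained by smoothing the real crossings.\<close>

definition smooth_fix :: "nat \<Rightarrow> vgen word \<Rightarrow> (nat \<Rightarrow> bool) set"
  where "smooth_fix m w = {v. (\<forall>i. v i \<longrightarrow> i < m) \<and> smooth.act w v = v}"

lemma finite_smooth_fix: "finite (smooth_fix m w)"
proof -
  have "smooth_fix m w \<subseteq> (\<lambda>A i. i \<in> A) ` Pow {..<m}"
  proof
    fix v assume "v \<in> smooth_fix m w"
    then have "v = (\<lambda>i. i \<in> {i. v i})" "{i. v i} \<in> Pow {..<m}"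
      by (auto simp: smooth_fix_def)
    then show "v \<in> (\<lambda>A i. i \<in> A) ` Pow {..<m}" by blast
  qed
  then show ?thesis by (rule finite_subset) simp
qed

text \<open>The action of \<open>u\<close> carries the fixed colourings of the conjugate to those of
  \<open>w\<close>. It keeps the support below \<open>m\<close>, since a word of degree
  \<open>m\<close> does not touch later coordinates.\<close>

lemma card_smooth_fix_conj:
  assumes "u \<in> words (vb_gens m)" "w \<in> words (vb_gens m)"
  shows "card (smooth_fix m (word_inv u @ w @ u)) = card (smooth_fix m w)"
proof (rule bij_betw_same_card)
  have support: "i < m" if "z \<in> words (vb_gens m)" "smooth.act z v i" "\<forall>i. v i \<longrightarrow> i < m" for z v i
    using smooth.act_beyond[OF that(1), of i v] that(2,3) by (metis not_le)
  show "bij_betw (smooth.act u) (smooth_fix m (word_inv u @ w @ u)) (smooth_fix m w)"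
  proof (rule bij_betw_byWitness[where f' = "smooth.act (word_inv u)"])
    show "smooth.act u ` smooth_fix m (word_inv u @ w @ u) \<subseteq> smooth_fix m w"
    proof clarify
      fix v assume "v \<in> smooth_fix m (word_inv u @ w @ u)"
      then have v: "\<forall>i. v i \<longrightarrow> i < m"
        and fixed: "smooth.act (word_inv u) (smooth.act w (smooth.act u v)) = v"
        by (auto simp: smooth_fix_def smooth.act_append)
      from fixed have "smooth.act w (smooth.act u v) = smooth.act u v"
        by (metis assms(1) smooth.act_word_inv(2))
      with v show "smooth.act u v \<in> smooth_fix m w"
        by (auto simp: smooth_fix_def not_less[symmetric] dest: support[OF assms(1)])
    qed
    show "smooth.act (word_inv u) ` smooth_fix m w \<subseteq> smooth_fix m (word_inv u @ w @ u)"
      by (auto simp: smooth_fix_def smooth.act_append smooth.act_word_inv[OF assms(1)]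
          dest: support[OF word_inv_words[OF assms(1)]])
  qed (simp_all add: smooth.act_word_inv[OF assms(1)])
qed

text \<open>After smoothing, the new strand, which has index \<open>m\<close>, is a cycle of its
  own. Its colour is free, which doubles the count.\<close>

lemma card_smooth_fix_sigma:
  assumes w: "w \<in> words (vb_gens m)"
  shows "card (smooth_fix (Suc m) (w @ [(Sig m, e)])) = 2 * card (smooth_fix m w)"
proof -
  have letter: "smooth.act [(Sig m, e)] v = v" for v
    by (auto simp: step_def)
  have "bij_betw (\<lambda>v. (v(m := False), v m))
      (smooth_fix (Suc m) (w @ [(Sig m, e)])) (smooth_fix m w \<times> UNIV)"
  proof (rule bij_betw_byWitness[where f' = "\<lambda>(v, x). v(m := x)"])
    show "(\<lambda>v. (v(m := False), v m)) ` smooth_fix (Suc m) (w @ [(Sig m, e)])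
        \<subseteq> smooth_fix m w \<times> UNIV"
      by (auto simp: smooth_fix_def smooth.act_append letter smooth.act_upd_beyond[OF w] less_Suc_eq
          simp del: smooth.act_Cons split: if_splits)
    show "(\<lambda>(v, x). v(m := x)) ` (smooth_fix m w \<times> UNIV)
        \<subseteq> smooth_fix (Suc m) (w @ [(Sig m, e)])"
      by (auto simp: smooth_fix_def smooth.act_append letter smooth.act_upd_beyond[OF w] less_Suc_eq
          simp del: smooth.act_Cons split: if_splits)
  qed (auto simp: smooth_fix_def fun_eq_iff)
  then show ?thesis
    by (simp add: bij_betw_same_card card_cartesian_product)
qed

text \<open>The flip inserts the new strand into the cycle of strand \<open>m - 1\<close>, so its
  colour is forced and the count stays the same.\<close>

lemma card_smooth_fix_tau:
  assumes w: "w \<in> words (vb_gens m)" and m: "1 \<le> m"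
  shows "card (smooth_fix (Suc m) (w @ [(Tau m, e)])) = card (smooth_fix m w)"
proof (rule bij_betw_same_card)
  \<comment> \<open>Since \<open>w\<close> does not touch coordinate \<open>m\<close>, comparing
    that coordinate on both sides gives \<open>v m = v (m - 1)\<close>. The flip then fixes
    \<open>v\<close>.\<close>
  have eq: "v m = v (m - 1) \<and> smooth.act w v = v" if "smooth.act w (swap_step m v) = v" for v
  proof -
    have "v m = swap_step m v m"
      using that smooth.act_beyond[OF w order_refl, of "swap_step m v"] by simp
    then have "v m = v (m - 1)" by (simp add: step_def)
    moreover from this have "swap_step m v = v"
      by (auto simp: step_def fun_eq_iff)
    ultimately show ?thesis using that by simp
  qed
  have swap: "swap_step m (v(m := v (m - 1))) = v(m := v (m - 1))" for v :: "nat \<Rightarrow> bool"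
    using m by (auto simp: step_def fun_eq_iff)
  show "bij_betw (\<lambda>v. v(m := False))
      (smooth_fix (Suc m) (w @ [(Tau m, e)])) (smooth_fix m w)"
  proof (rule bij_betw_byWitness[where f' = "\<lambda>v. v(m := v (m - 1))"])
    show "(\<lambda>v. v(m := False)) ` smooth_fix (Suc m) (w @ [(Tau m, e)]) \<subseteq> smooth_fix m w"
      by (auto simp: smooth_fix_def smooth.act_append smooth.act_upd_beyond[OF w] less_Suc_eq
          dest!: eq split: if_splits)
    show "(\<lambda>v. v(m := v (m - 1))) ` smooth_fix m w
        \<subseteq> smooth_fix (Suc m) (w @ [(Tau m, e)])"
    proof clarify
      fix v assume v: "v \<in> smooth_fix m w"
      then have "smooth.act (w @ [(Tau m, e)]) (v(m := v (m - 1))) = v(m := v (m - 1))"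
        unfolding smooth.act_append smooth.act_Cons smooth.act_Nil smooth.letter_act.simps swap
        by (simp add: smooth.act_upd_beyond[OF w] smooth_fix_def)
      with v show "v(m := v (m - 1)) \<in> smooth_fix (Suc m) (w @ [(Tau m, e)])"
        by (simp add: smooth_fix_def less_Suc_eq)
    qed
    show "\<forall>v\<in>smooth_fix (Suc m) (w @ [(Tau m, e)]).
        (v(m := False))(m := (v(m := False)) (m - 1)) = v"
      using m by (auto simp: smooth_fix_def smooth.act_append fun_eq_iff[of "fun_upd _ _ _"] dest!: eq)
    show "\<forall>v\<in>smooth_fix m w. (v(m := v (m - 1)))(m := False) = v"
      by (auto simp: smooth_fix_def fun_eq_iff[of "fun_upd _ _ _"])
  qed
qed


section \<open>The Burau determinant\<close>

definition lin :: "rat \<Rightarrow> rat \<Rightarrow> rat \<Rightarrow> rat \<Rightarrow> rat"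
  where "lin a b x y = a * x + b * y"

interpretation burau: vb_switch "lin (- 3) 2" "lin 2 0" "lin 0 (1/2)" "lin (1/2) (3/4)"
  by unfold_locales (simp_all add: lin_def field_simps)

definition unit_fun :: "nat \<Rightarrow> nat \<Rightarrow> rat"
  where "unit_fun c i = (if i = c then 1 else 0)"

lemma step_lin:
  "step (lin a b) (lin c d) i v r =
    (if r = i then c * v (i - 1) + d * v i else if r = i - 1 then a * v (i - 1) + b * v i else v r)"
  by (simp add: step_def lin_def)

lemma step_linear:
  "step (lin a b) (lin c d) i (\<lambda>j. p * u j + q * v j) k
    = p * step (lin a b) (lin c d) i u k + q * step (lin a b) (lin c d) i v k"
  by (simp add: step_lin algebra_simps)

lemma swap_step_linear: "swap_step = step (lin 0 1) (lin 1 0)"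
  by (simp add: step_def lin_def fun_eq_iff)

text \<open>Real crossings, their inverses and flips all become linear 2 by 2 blocks, so the
  inductions below need only one case per letter.\<close>

lemma burau_letter_step:
  obtains a b c d i where
    "burau.letter_act (x, e) = step (lin a b) (lin c d) i" "x = Sig i \<or> x = Tau i"
proof (cases x)
  case (Sig i)
  then show thesis
    using that[of "- 3" 2 2 0 i] that[of 0 "1/2" "1/2" "3/4" i] by (cases e) auto
next
  case (Tau i)
  then show thesis
    using that[of 0 1 1 0 i] by (auto simp: swap_step_linear)
qed

lemma burau_act_linear:
  "burau.act w (\<lambda>j. p * u j + q * v j) = (\<lambda>k. p * burau.act w u k + q * burau.act w v k)"
proof (induction w)
  case (Cons x w)
  obtain h e where "x = (h, e)" by force
  moreover obtain a b c d i where "burau.letter_act (h, e) = step (lin a b) (lin c d) i"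
    by (rule burau_letter_step)
  ultimately show ?case
    by (intro ext) (simp add: \<open>x = (h, e)\<close> Cons.IH step_linear)
qed simp

text \<open>Outputs below \<open>m\<close> depend only on inputs below \<open>m\<close>, so the
  infinite colouring may be cut to a vector of length \<open>m\<close>. This is what makes
  \<open>burau_mat\<close> multiplicative.\<close>

lemma burau_act_expand:
  "w \<in> words (vb_gens m) \<Longrightarrow> r < m \<Longrightarrow>
    burau.act w v r = (\<Sum>c<m. v c * burau.act w (unit_fun c) r)"
proof (induction w arbitrary: r)
  case Nil
  then show ?case by (simp add: unit_fun_def if_distrib[of "(*) _"] cong: if_cong)
next
  case (Cons x w)
  obtain h e where x: "x = (h, e)" by force
  obtain a b c d i where
    step: "burau.letter_act (h, e) = step (lin a b) (lin c d) i"
    and h: "h = Sig i \<or> h = Tau i"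
    by (rule burau_letter_step)
  have i: "i < m" "i - 1 < m"
    using Cons.prems(1) h by (auto simp: x vb_gens_def)
  have "w \<in> words (vb_gens m)"
    using Cons.prems by simp
  note IH = Cons.IH[OF this]
  show ?case
    using i Cons.prems(2)
    by (auto simp: x step step_lin IH[of i] IH[of "i - 1"] IH[of r] sum_distrib_left
        sum.distrib[symmetric] algebra_simps simp del: One_nat_def intro!: sum.cong)
qed

definition burau_mat :: "nat \<Rightarrow> vgen word \<Rightarrow> rat mat"
  where "burau_mat m w = mat m m (\<lambda>(r, c). burau.act w (unit_fun c) r)"

lemma burau_mat_carrier [simp]: "burau_mat m w \<in> carrier_mat m m"
  by (simp add: burau_mat_def)

lemma burau_mat_dim [simp]: "dim_row (burau_mat m w) = m" "dim_col (burau_mat m w) = m"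
  by (simp_all add: burau_mat_def)

lemma burau_mat_Nil: "burau_mat m [] = 1\<^sub>m m"
  by (rule eq_matI) (auto simp: burau_mat_def unit_fun_def)

lemma burau_mat_append:
  assumes "u \<in> words (vb_gens m)"
  shows "burau_mat m (u @ w) = burau_mat m u * burau_mat m w"
proof (rule eq_matI)
  fix r c
  assume "r < dim_row (burau_mat m u * burau_mat m w)" "c < dim_col (burau_mat m u * burau_mat m w)"
  then have "r < m" "c < m" by (simp_all add: burau_mat_def)
  then show "burau_mat m (u @ w) $$ (r, c) = (burau_mat m u * burau_mat m w) $$ (r, c)"
    using burau_act_expand[OF assms, of r "burau.act w (unit_fun c)"]
    by (simp add: burau_mat_def burau.act_append scalar_prod_def mult.commute lessThan_atLeast0)
qed (simp_all add: burau_mat_def)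

definition burau_det :: "nat \<Rightarrow> vgen word \<Rightarrow> rat"
  where "burau_det m w = det (1\<^sub>m m - burau_mat m w)"

text \<open>With \<open>?Q * ?P = 1\<close> one has
  \<open>1 - ?Q * ?A * ?P = ?Q * (1 - ?A) * ?P\<close>, and the outer determinants multiply to
  1.\<close>

lemma burau_det_conj:
  assumes u: "u \<in> words (vb_gens m)" and w: "w \<in> words (vb_gens m)"
  shows "burau_det m (word_inv u @ w @ u) = burau_det m w"
proof -
  let ?P = "burau_mat m u" and ?Q = "burau_mat m (word_inv u)" and ?A = "burau_mat m w"
  have "burau_mat m (word_inv u @ u) = burau_mat m []"
    using burau.act_cong[OF word_inv_cancel[OF u]] by (simp add: burau_mat_def)
  then have QP: "?Q * ?P = 1\<^sub>m m"
    by (simp add: burau_mat_append[OF word_inv_words[OF u]] burau_mat_Nil)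
  have "burau_mat m (word_inv u @ w @ u) = ?Q * (?A * ?P)"
    by (simp add: burau_mat_append[OF word_inv_words[OF u]] burau_mat_append[OF w])
  moreover have "?Q * ((1\<^sub>m m - ?A) * ?P) = 1\<^sub>m m - ?Q * (?A * ?P)"
    using QP by (simp add: minus_mult_distrib_mat[of _ m m _ _ m] left_mult_one_mat[of _ m m]
        mult_minus_distrib_mat[of _ m m _ m] mult_carrier_mat[of _ m m _ m])
  ultimately have "burau_det m (word_inv u @ w @ u) = det (?Q * ((1\<^sub>m m - ?A) * ?P))"
    by (simp add: burau_det_def)
  also have "\<dots> = det ?Q * det ?P * det (1\<^sub>m m - ?A)"
    by (subst det_mult[of _ m], simp, rule mult_carrier_mat[of _ m m],
        (auto intro: minus_carrier_mat)[2], subst det_mult[of _ m], auto intro: minus_carrier_mat)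
  also have "det ?Q * det ?P = 1"
    using det_mult[of ?Q m ?P] by (simp add: QP)
  finally show ?thesis by (simp add: burau_det_def)
qed

text \<open>The last hypothesis says that \<open>1 - N\<close> is singular for the block
  \<open>N\<close> with rows \<open>(a, b)\<close> and \<open>(c, d)\<close>. One column operation
  then makes the large matrix block upper triangular with corner \<open>1 - d\<close>, for all three
  types of right stabilization.\<close>

lemma burau_det_stab:
  assumes w: "w \<in> words (vb_gens m)" and m: "1 \<le> m"
    and x: "burau.letter_act x = step (lin a b) (lin c d) m"
    and d: "d \<noteq> 1" and eigenvalue_one: "b * c = (1 - a) * (1 - d)"
  shows "burau_det (Suc m) (w @ [x]) = (1 - d) * burau_det m w"
proof -
  obtain k where k: "m = Suc k"
    using m by (metis Suc_le_D One_nat_def)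
  define \<alpha> where "\<alpha> r j = burau.act w (unit_fun j) r" for r j
  \<comment> \<open>On \<open>m + 1\<close> coordinates \<open>w\<close> is block diagonal with
    corner 1. Above the corner the expansion vanishes, since \<open>unit_fun m\<close> is zero on
    all indices below \<open>m\<close>.\<close>
  have last: "\<alpha> r m = unit_fun m r" if "r \<le> m" for r
  proof (cases "r = m")
    case True
    then show ?thesis using burau.act_beyond[OF w] by (simp add: \<alpha>_def)
  next
    case False
    with that have "r < m" by simp
    from burau_act_expand[OF w this, of "unit_fun m"] show ?thesis
      using \<open>r < m\<close> by (simp add: \<alpha>_def unit_fun_def)
  qed
  have bottom: "\<alpha> m j = 0" if "j < m" for j
    using burau.act_beyond[OF w] that by (simp add: \<alpha>_def unit_fun_def)
  have entry: "burau.act (w @ [x]) (unit_fun j) r =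
      (if j < k then \<alpha> r j else if j = k then a * \<alpha> r k + c * \<alpha> r m
       else b * \<alpha> r k + d * \<alpha> r m)" if "j \<le> m" for j r
  proof -
    consider "j < k" | "j = k" | "j = m"
      using \<open>j \<le> m\<close> k by linarith
    then show ?thesis
    proof cases
      case 1
      then have "burau.letter_act x (unit_fun j) = unit_fun j"
        by (auto simp: x k step_Suc lin_def unit_fun_def fun_eq_iff)
      then show ?thesis using 1 by (simp add: burau.act_append \<alpha>_def)
    next
      case 2
      then have "burau.letter_act x (unit_fun j) = (\<lambda>i. a * unit_fun k i + c * unit_fun m i)"
        by (auto simp: x k step_Suc lin_def unit_fun_def fun_eq_iff)
      then show ?thesis using 2 by (simp add: burau.act_append \<alpha>_def burau_act_linear)
    next
      case 3
      then have "burau.letter_act x (unit_fun j) = (\<lambda>i. b * unit_fun k i + d * unit_fun m i)"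
        by (auto simp: x k step_Suc lin_def unit_fun_def fun_eq_iff)
      then show ?thesis using 3 k by (simp add: burau.act_append \<alpha>_def burau_act_linear)
    qed
  qed
  let ?J = "1\<^sub>m (Suc m) - burau_mat (Suc m) (w @ [x])"
  let ?J' = "four_block_mat (1\<^sub>m m - burau_mat m w) (mat m 1 (\<lambda>(r, _). - b * \<alpha> r k))
    (0\<^sub>m 1 m) (mat 1 1 (\<lambda>_. 1 - d))"
  have bc: "a + b * c / (1 - d) = 1"
    using d eigenvalue_one by (simp add: field_simps)
  text \<open>Eigenvalue one of the block makes the column operation restore \<open>1 - M\<close> in the upper left
    corner.\<close>
  have J': "addcol (c / (1 - d)) k m ?J = ?J'"
  proof (rule eq_matI)
    fix r j assume "r < dim_row ?J'" "j < dim_col ?J'"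
    then have rj: "r \<le> m" "j \<le> m" by simp_all
    consider "r < m" "j < k" | "r < m" "j = k" | "r < m" "j = m"
      | "r = m" "j < k" | "r = m" "j = k" | "r = m" "j = m"
      using rj k by linarith
    then show "addcol (c / (1 - d)) k m ?J $$ (r, j) = ?J' $$ (r, j)"
    proof cases
      case 2
      then have "addcol (c / (1 - d)) k m ?J $$ (r, j) =
          (if r = k then 1 else 0) - (a + b * c / (1 - d)) * \<alpha> r k"
        using k last[of r] by (simp add: burau_mat_def entry unit_fun_def algebra_simps)
      also have "\<dots> = ?J' $$ (r, j)"
        using 2 k by (simp add: bc burau_mat_def \<alpha>_def)
      finally show ?thesis .
    next
      case 5
      then show ?thesis
        using k d last[of m] bottom[of k] by (simp add: burau_mat_def entry unit_fun_def field_simps)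
    qed (use k last[of r] bottom[of j] bottom[of k] in
        \<open>auto simp: burau_mat_def entry unit_fun_def \<alpha>_def[symmetric]\<close>)
  qed simp_all
  have "det ?J = det ?J'"
    unfolding J'[symmetric] using k
    by (intro det_addcol[symmetric, of _ "Suc m"]) auto
  also have "\<dots> = burau_det m w * (1 - d)"
    by (subst det_four_block_mat_lower_left_zero) (auto simp: burau_det_def det_single)
  finally show ?thesis by (simp add: burau_det_def)
qed


section \<open>Invariance under the moves\<close>

text \<open>Here \<open>st = 4\<close>, so \<open>(st) powr (c/2)\<close> is the number of fixed colourings.\<close>

definition inv_word :: "nat \<Rightarrow> vgen word \<Rightarrow> rat"
  where "inv_word m w = burau_det m w * of_nat (card (smooth_fix m w)) / 2 powi writhe w"

lemma inv_word_cong: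
  assumes "(u, v) \<in> pres_cong (vb_gens m) (vb_rels m)"
  shows "inv_word m u = inv_word m v"
  using burau.act_cong[OF assms] smooth.act_cong[OF assms] writhe_cong[OF assms]
  by (simp add: inv_word_def burau_det_def burau_mat_def smooth_fix_def)

lemma inv_word_conj:
  assumes "u \<in> words (vb_gens m)" "w \<in> words (vb_gens m)"
  shows "inv_word m (word_inv u @ w @ u) = inv_word m w"
  using assms
  by (simp add: inv_word_def burau_det_conj card_smooth_fix_conj writhe_append writhe_word_inv)

text \<open>For a positive crossing the doubled count cancels the extra factor 2 of the writhe term.
  For a negative one, count and writhe term contribute 2 each, cancelling the determinant factor
  \<open>1/4\<close>.\<close>

lemma inv_word_stab_sigma:
  assumes "w \<in> words (vb_gens m)" "1 \<le> m"
  shows "inv_word (Suc m) (w @ [(Sig m, e)]) = inv_word m w"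
proof -
  have "burau_det (Suc m) (w @ [(Sig m, e)]) = (if e then 1 else 1/4) * burau_det m w"
    using burau_det_stab[OF assms, of "(Sig m, e)" "- 3" 2 2 0]
      burau_det_stab[OF assms, of "(Sig m, e)" 0 "1/2" "1/2" "3/4"]
    by (cases e) simp_all
  then show ?thesis
    by (simp add: inv_word_def card_smooth_fix_sigma[OF assms(1)] writhe_append power_int_add
        power_int_diff, simp add: writhe_def power_int_minus)
qed

lemma inv_word_stab_tau:
  assumes "w \<in> words (vb_gens m)" "1 \<le> m"
  shows "inv_word (Suc m) (w @ [(Tau m, e)]) = inv_word m w"
proof -
  have "burau_det (Suc m) (w @ [(Tau m, e)]) = burau_det m w"
    using burau_det_stab[OF assms, of "(Tau m, e)" 0 1 1 0] by (simp add: swap_step_linear)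
  then show ?thesis
    by (simp add: inv_word_def card_smooth_fix_tau[OF assms] writhe_append, simp add: writhe_def)
qed

section \<open>From words to braids\<close>

definition inv_braid :: "nat \<times> vbraid \<Rightarrow> rat"
  where "inv_braid p = the_elem (inv_word (fst p) ` snd p)"

text \<open>By \<open>inv_word_cong\<close> the value is constant on a class, so the image under
  \<open>inv_word\<close> is a singleton and \<open>the_elem\<close> picks that value.\<close>

lemma inv_braid_class:
  assumes "w \<in> words (vb_gens m)"
  shows "inv_braid (m, vb_class m w) = inv_word m w"
proof -
  have "inv_word m ` vb_class m w = {inv_word m w}"
    using pres_cong.refl[OF assms] by (force simp: vb_class_def dest: inv_word_cong)
  then show ?thesis by (simp add: inv_braid_def)
qed

lemma VB_carrierE:
  assumes "b \<in> carrier (VB m)"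
  obtains w where "w \<in> words (vb_gens m)" "b = vb_class m w"
  using assms unfolding VB_def vb_class_def by (rule pres_carrierE)

lemma vb_class_mult:
  "u \<in> words (vb_gens m) \<Longrightarrow> v \<in> words (vb_gens m) \<Longrightarrow>
    vb_class m u \<otimes>\<^bsub>VB m\<^esub> vb_class m v = vb_class m (u @ v)"
  unfolding VB_def vb_class_def by (rule pres_mult_class)

lemma vb_class_inv:
  assumes w: "w \<in> words (vb_gens m)"
  shows "inv\<^bsub>VB m\<^esub> vb_class m w = vb_class m (word_inv w)"
proof (rule group.inv_equality[OF group_VB])
  have "vb_class m (word_inv w @ w) = vb_class m []"
    unfolding vb_class_def by (intro equiv_class_eq[OF equiv_pres_cong] word_inv_cancel w)
  then show "vb_class m (word_inv w) \<otimes>\<^bsub>VB m\<^esub> vb_class m w = \<one>\<^bsub>VB m\<^esub>"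
    by (simp add: vb_class_mult word_inv_words[OF w] w)
      (simp add: VB_def vb_class_def presented_group_def)
  show "vb_class m w \<in> carrier (VB m)" "vb_class m (word_inv w) \<in> carrier (VB m)"
    using w word_inv_words[OF w] unfolding VB_def vb_class_def by (auto intro: pres_class_carrier)
qed

lemma vb_class_mult_letter:
  assumes "w \<in> words (vb_gens m)" "1 \<le> i" "i < m"
  shows "vb_class m w \<otimes>\<^bsub>VB m\<^esub> vsigma m i = vb_class m (w @ [(Sig i, True)])"
    and "vb_class m w \<otimes>\<^bsub>VB m\<^esub> inv\<^bsub>VB m\<^esub> vsigma m i = vb_class m (w @ [(Sig i, False)])"
    and "vb_class m w \<otimes>\<^bsub>VB m\<^esub> vtau m i = vb_class m (w @ [(Tau i, True)])"
proof -
  have letter: "[(Sig i, e)] \<in> words (vb_gens m)" "[(Tau i, e)] \<in> words (vb_gens m)" for e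
    using assms(2,3) by (auto simp: vb_gens_def)
  have inv: "inv\<^bsub>VB m\<^esub> vsigma m i = vb_class m [(Sig i, False)]"
    using vb_class_inv[OF letter(1)[of True]] by (simp add: vsigma_def word_inv_def)
  show "vb_class m w \<otimes>\<^bsub>VB m\<^esub> vsigma m i = vb_class m (w @ [(Sig i, True)])"
    and "vb_class m w \<otimes>\<^bsub>VB m\<^esub> inv\<^bsub>VB m\<^esub> vsigma m i = vb_class m (w @ [(Sig i, False)])"
    and "vb_class m w \<otimes>\<^bsub>VB m\<^esub> vtau m i = vb_class m (w @ [(Tau i, True)])"
    unfolding inv unfolding vsigma_def vtau_def by (rule vb_class_mult[OF assms(1) letter(1)]
        vb_class_mult[OF assms(1) letter(2)])+
qed

lemma inv_braid_right_stab:
  assumes "right_stab p q"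
  shows "inv_braid p = inv_braid q"
proof -
  have stab: "inv_braid (m, b) =
        inv_braid (m + 1, vb_iota m 0 1 b \<otimes>\<^bsub>VB (m + 1)\<^esub> vsigma (m + 1) m)"
    "inv_braid (m, b) =
        inv_braid (m + 1, vb_iota m 0 1 b \<otimes>\<^bsub>VB (m + 1)\<^esub> inv\<^bsub>VB (m + 1)\<^esub> vsigma (m + 1) m)"
    "inv_braid (m, b) =
        inv_braid (m + 1, vb_iota m 0 1 b \<otimes>\<^bsub>VB (m + 1)\<^esub> vtau (m + 1) m)"
    if m: "1 \<le> m" and b: "b \<in> carrier (VB m)" for m b
  proof -
    obtain w where w: "w \<in> words (vb_gens m)" "b = vb_class m w"
      using b by (rule VB_carrierE)
    \<comment> \<open>Adding a strand on the right renumbers no generator, so on words a right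
      stabilization just appends a letter with index \<open>m\<close>.\<close>
    have "shift_gen 0 x = x" for x
      by (cases x) auto
    then have shift: "shift_word 0 w = w"
      by (auto simp: shift_word_def intro!: map_idI)
    have iota: "vb_iota m 0 1 (vb_class m w) = vb_class (m + 1) w"
      using vb_iota_class[OF w(1), of 0 1] by (simp add: shift)
    have w': "w \<in> words (vb_gens (m + 1))"
      using shift_word_words[OF w(1), of 0 1] by (simp add: shift)
    have letter: "w @ [(Sig m, e)] \<in> words (vb_gens (m + 1))"
      "w @ [(Tau m, e)] \<in> words (vb_gens (m + 1))" for e
      using w' m by (auto simp: vb_gens_def)
    note simps = w(2) iota vb_class_mult_letter[OF w' m less_add_one] inv_braid_class[OF letter(1)]
      inv_braid_class[OF letter(2)] inv_braid_class[OF w(1)]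
    show "inv_braid (m, b) =
        inv_braid (m + 1, vb_iota m 0 1 b \<otimes>\<^bsub>VB (m + 1)\<^esub> vsigma (m + 1) m)"
      "inv_braid (m, b) =
        inv_braid (m + 1, vb_iota m 0 1 b \<otimes>\<^bsub>VB (m + 1)\<^esub> inv\<^bsub>VB (m + 1)\<^esub> vsigma (m + 1) m)"
      "inv_braid (m, b) =
        inv_braid (m + 1, vb_iota m 0 1 b \<otimes>\<^bsub>VB (m + 1)\<^esub> vtau (m + 1) m)"
      unfolding simps
      using inv_word_stab_sigma[OF w(1) m] inv_word_stab_tau[OF w(1) m] by simp_all
  qed
  from assms show ?thesis
  proof cases
    case (pos m b)
    then show ?thesis by (simp only: stab(1)[OF pos(3,4)])
  next
    case (neg m b)
    then show ?thesis by (simp only: stab(2)[OF neg(3,4)])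
  next
    case (virt m b)
    then show ?thesis by (simp only: stab(3)[OF virt(3,4)])
  qed
qed

lemma inv_braid_move:
  assumes "vm_move p q"
  shows "inv_braid p = inv_braid q"
  using assms
proof cases
  case (vm1 m b1 b2)
  obtain w where w: "w \<in> words (vb_gens m)" "b1 = vb_class m w"
    using vm1(4) by (rule VB_carrierE)
  obtain u where u: "u \<in> words (vb_gens m)" "b2 = vb_class m u"
    using vm1(5) by (rule VB_carrierE)
  have "inv\<^bsub>VB m\<^esub> b2 \<otimes>\<^bsub>VB m\<^esub> b1 \<otimes>\<^bsub>VB m\<^esub> b2 = vb_class m (word_inv u @ w @ u)"
    by (simp add: w u vb_class_inv vb_class_mult word_inv_words)
  then show ?thesis
    by (simp add: vm1(1,2) w inv_braid_class u word_inv_words inv_word_conj)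
qed (simp_all add: inv_braid_right_stab)

lemma inv_braid_related:
  assumes "vm_related p q"
  shows "inv_braid p = inv_braid q"
  using assms by (induction rule: rtranclp_induct) (simp_all add: inv_braid_move)


section \<open>A left stabilization that changes the invariant\<close>

lemma smooth_fix_act_cong:
  "(\<And>v. smooth.act u v = smooth.act w v) \<Longrightarrow> smooth_fix m u = smooth_fix m w"
  by (simp add: smooth_fix_def)

lemma smooth_act_sigma: "smooth.letter_act (Sig i, e) v = v"
  by (auto simp: step_def)

lemma card_smooth_fix_Nil: "card (smooth_fix m []) = 2 ^ m"
proof (induction m)
  case 0
  have "smooth_fix 0 [] = {\<lambda>_. False}"
    by (auto simp: smooth_fix_def)
  then show ?case by simp
next
  case (Suc m)
  \<comment> \<open>Smoothing ignores real crossings, so a dummy \<open>sg m\<close> may be appended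
    and the doubling lemma applied.\<close>
  have "smooth_fix (Suc m) [] = smooth_fix (Suc m) ([] @ [sg m])"
    by (rule smooth_fix_act_cong) (simp add: smooth_act_sigma del: smooth.letter_act.simps)
  then show ?case
    using Suc by (simp add: card_smooth_fix_sigma del: append_Nil)
qed

text \<open>Smoothing leaves one flip, a virtual stabilization of the trivial braid on one
  strand.\<close>

lemma card_smooth_fix_base: "card (smooth_fix 2 [sg 1, ta 1]) = 2"
proof -
  have "smooth_fix 2 [sg 1, ta 1] = smooth_fix (Suc 1) ([] @ [ta 1])"
    unfolding Suc_1 by (rule smooth_fix_act_cong) (simp add: smooth_act_sigma del: smooth.letter_act.simps)
  then show ?thesis
    by (simp only: card_smooth_fix_tau card_smooth_fix_Nil lists.Nil le_refl) simp
qed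

text \<open>Likewise, smoothing leaves a virtual stabilization of the trivial braid on two strands,
  whence \<open>2 ^ 2\<close>.\<close>

lemma card_smooth_fix_left: "card (smooth_fix 3 [sg 2, ta 2, (Sig 1, e)]) = 4"
proof -
  have "smooth_fix 3 [sg 2, ta 2, (Sig 1, e)] = smooth_fix (Suc 2) ([] @ [ta 2])"
    unfolding eval_nat_numeral(3)[symmetric]
    by (simp add: smooth_act_sigma smooth_fix_def del: smooth.letter_act.simps)
  then show ?thesis
    by (simp only: card_smooth_fix_tau card_smooth_fix_Nil lists.Nil one_le_numeral) simp
qed

lemma burau_act_base:
  fixes v :: "nat \<Rightarrow> rat"
  defines "v' \<equiv> burau.act [sg 1, ta 1] v"
  shows "v' 0 = 2 * v 0 - 3 * v 1" and "v' 1 = 2 * v 1"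
  unfolding v'_def by (simp_all add: step_def) (simp_all add: lin_def)

lemma burau_det_base: "burau_det 2 [sg 1, ta 1] = 1"
proof -
  define A where "A = 1\<^sub>m 2 - burau_mat 2 [sg 1, ta 1]"
  have A: "A \<in> carrier_mat 2 2"
    by (auto simp: A_def)
  have below: "i < 2 \<longleftrightarrow> i = 0 \<or> i = 1" for i :: nat
    by auto
  have entries: "A $$ (0, 0) = - 1" "A $$ (1, 1) = - 1" "A $$ (1, 0) = 0"
    by (auto simp: A_def burau_mat_def burau_act_base unit_fun_def simp del: burau.act_Cons One_nat_def)
  have "upper_triangular A"
    using A entries by (auto simp: upper_triangular_def below simp del: One_nat_def)
  moreover have "prod_list (diag_mat A) = 1"
    using A entries by (simp add: diag_mat_def upt_rec)
  ultimately show ?thesis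
    using det_upper_triangular[OF _ A] by (simp add: burau_det_def A_def)
qed

lemma burau_act_left:
  fixes v :: "nat \<Rightarrow> rat" and e :: bool
  defines "v' \<equiv> burau.act [sg 2, ta 2, (Sig 1, e)] v"
  shows "v' 0 = (if e then - 3 * v 0 + 2 * v 1 else v 1 / 2)"
    and "v' 1 = (if e then 4 * v 0 else v 0 + 3/2 * v 1) - 3 * v 2"
    and "v' 2 = 2 * v 2"
  unfolding v'_def by (simp_all add: step_def) (simp_all add: lin_def)

lemma burau_det_left: "burau_det 3 [sg 2, ta 2, (Sig 1, e)] = (if e then 4 else 1)"
proof -
  let ?A = "1\<^sub>m 3 - burau_mat 3 [sg 2, ta 2, (Sig 1, e)]"
  \<comment> \<open>The multiple of column 1 added to column 0 is chosen to clear entry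
    \<open>(1, 0)\<close>, the only nonzero entry below the diagonal.\<close>
  define B where "B = addcol (if e then 4 else - 2) 0 1 ?A"
  have B: "B \<in> carrier_mat 3 3"
    by (auto simp: B_def)
  have below: "i < 3 \<longleftrightarrow> i = 0 \<or> i = 1 \<or> i = 2" "i < 2 \<longleftrightarrow> i = 0 \<or> i = 1" for i :: nat
    by auto
  have entries: "B $$ (0, 0) = (if e then - 4 else 2)" "B $$ (1, 1) = (if e then 1 else - 1/2)"
    "B $$ (2, 2) = - 1" "B $$ (1, 0) = 0" "B $$ (2, 0) = 0" "B $$ (2, 1) = 0"
    by (auto simp: B_def burau_mat_def burau_act_left unit_fun_def simp del: burau.act_Cons One_nat_def)
  have "upper_triangular B"
    using B entries by (auto simp: upper_triangular_def below simp del: One_nat_def)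
  moreover have "prod_list (diag_mat B) = (if e then 4 else 1)"
    using B entries by (simp add: diag_mat_def upt_rec numeral_2_eq_2[symmetric])
  moreover have "det B = det ?A"
    unfolding B_def by (rule det_addcol[of _ 3]) auto
  ultimately show ?thesis
    using det_upper_triangular[OF _ B] by (simp add: burau_det_def)
qed

text \<open>The invariant of the base braid is \<open>1 * 2 / 2 = 1\<close>. The positive left
  stabilization gives \<open>4 * 4 / 2 ^ 2 = 4\<close>, and the negative one, of writhe 0, gives
  \<open>1 * 4 / 1 = 4\<close>.\<close>

lemma left_stab_not_related:
  defines "b \<equiv> vb_class 2 [sg 1, ta 1]"
  shows "\<not> vm_related (2, b) (2 + 1, vb_iota 2 1 0 b \<otimes>\<^bsub>VB (2 + 1)\<^esub> vsigma (2 + 1) 1)"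
    and "\<not> vm_related (2, b)
      (2 + 1, vb_iota 2 1 0 b \<otimes>\<^bsub>VB (2 + 1)\<^esub> inv\<^bsub>VB (2 + 1)\<^esub> vsigma (2 + 1) 1)"
proof -
  have w: "[sg 1, ta 1] \<in> words (vb_gens 2)" "[sg 2, ta 2] \<in> words (vb_gens (2 + 1))"
    "[sg 2, ta 2] @ [(Sig 1, e)] \<in> words (vb_gens (2 + 1))" for e
    by (auto simp: vb_gens_def)
  have "shift_word 1 [sg 1, ta 1] = [sg 2, ta 2]"
    by (simp add: shift_word_def)
  then have iota: "vb_iota 2 1 0 b = vb_class (2 + 1) [sg 2, ta 2]"
    using vb_iota_class[OF w(1), of 1 0] by (simp add: b_def)
  have base: "inv_braid (2, b) = 1"
    unfolding b_def inv_braid_class[OF w(1)] inv_word_def burau_det_base card_smooth_fix_base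
    by (simp add: writhe_def)
  have left: "inv_braid (2 + 1, vb_class (2 + 1) ([sg 2, ta 2] @ [(Sig 1, e)])) = 4" for e
    unfolding inv_braid_class[OF w(3)]
    using burau_det_left[of e] card_smooth_fix_left[of e] by (simp add: inv_word_def writhe_def)
  have "inv_braid (2 + 1, vb_iota 2 1 0 b \<otimes>\<^bsub>VB (2 + 1)\<^esub> vsigma (2 + 1) 1) = 4"
    and "inv_braid
      (2 + 1, vb_iota 2 1 0 b \<otimes>\<^bsub>VB (2 + 1)\<^esub> inv\<^bsub>VB (2 + 1)\<^esub> vsigma (2 + 1) 1) = 4"
    unfolding iota by (subst vb_class_mult_letter[OF w(2)], simp, simp, rule left)+
  then show "\<not> vm_related (2, b) (2 + 1, vb_iota 2 1 0 b \<otimes>\<^bsub>VB (2 + 1)\<^esub> vsigma (2 + 1) 1)"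
    and "\<not> vm_related (2, b)
      (2 + 1, vb_iota 2 1 0 b \<otimes>\<^bsub>VB (2 + 1)\<^esub> inv\<^bsub>VB (2 + 1)\<^esub> vsigma (2 + 1) 1)"
    using base inv_braid_related by fastforce+
qed

theorem proposition3p5:
  "(\<exists>p q. left_stab_pos p q \<and> \<not> vm_related p q) \<and>
   (\<exists>p q. left_stab_neg p q \<and> \<not> vm_related p q)"
proof -
  have b: "vb_class 2 [sg 1, ta 1] \<in> carrier (VB 2)"
    unfolding VB_def vb_class_def by (rule pres_class_carrier) (auto simp: vb_gens_def)
  from left_stab_not_related left_stab_pos.intros[OF one_le_numeral b]
    left_stab_neg.intros[OF one_le_numeral b]
  show ?thesis by blast
qed

end
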